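(* Let $G\in\mathcal{G}(n,p)$ with $p=p(n)=O(1/n)$. Then, a.a.s., $\chi_P(G)=\Theta(1)=\Theta(\chi(G))$.
   Context: $\mathcal{G}(n,p)$ is the binomial random graph on vertex set $\{1,\dots,n\}$ in which each of the $\binom n2$ pairs is an edge independently with probability $p$. An event holds asymptotically almost surely (a.a.s.) if its probability tends to $1$ as $n\to\infty$. $\chi(G)$ is the chromatic number. $\chi_P(G)$, the paintability (on-line choice number), is defined via the following game between Mr. Paint and Mrs. Correct on $G$, where each vertex initially has the same number of erasers: in each round Mr. Paint selects a subset of the (remaining) vertices and paints them with a new colour (never used before); Mrs. Correct then erases the colour from some of these vertices so that no two adjacent vertices keep the same colour, each erasure at a vertex using up one eraser at that vertex (she cannot erase at a vertex with no erasers left). Vertices whose colour is not erased are permanently coloured and removed. Mrs. Correct wins if all vertices become permanently coloured; Mr. Paint wins if at some point he presents two adjacent vertices neither of which has any eraser left. $G$ is $k$-paintable if Mrs. Correct has a winning strategy when each vertex initially has $k-1$ erasers; $\chi_P(G)$ is the least such $k$. *)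

theory Defs
  imports "HOL-Probability.Probability" "HOL-Library.Ramsey" "HOL-Library.Landau_Symbols"
begin

text \<open>
  A simple graph is given by a vertex set \<open>V\<close> and a set of edges \<open>E \<subseteq> [V]\<^bsup>2\<^esup>\<close>.
\<close>

definition gnp :: "nat \<Rightarrow> real \<Rightarrow> nat set set pmf" where
  "gnp n p = map_pmf (\<lambda>f. {e \<in> [{1..n}]\<^bsup>2\<^esup>. f e})
     (Pi_pmf ([{1..n}]\<^bsup>2\<^esup>) False (\<lambda>_. bernoulli_pmf p))"

definition aas :: "(nat \<Rightarrow> real) \<Rightarrow> (nat \<Rightarrow> nat set set \<Rightarrow> bool) \<Rightarrow> bool" where
  "aas p P \<longleftrightarrow> (\<lambda>n. measure_pmf.prob (gnp n (p n)) {E. P n E}) \<longlonglongrightarrow> 1"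

text \<open>
  For graph parameters \<open>X\<close> and \<open>Y\<close>: a.a.s.\ \<open>X(G) = \<Theta>(Y(G))\<close>, with constants
  depending only on the function \<open>p\<close>.
\<close>

definition aas_bigtheta ::
    "(nat \<Rightarrow> real) \<Rightarrow> (nat set \<Rightarrow> nat set set \<Rightarrow> nat) \<Rightarrow> (nat set \<Rightarrow> nat set set \<Rightarrow> nat) \<Rightarrow> bool" where
  "aas_bigtheta p X Y \<longleftrightarrow>
     (\<exists>c C :: real. c > 0 \<and> C > 0 \<and>
        aas p (\<lambda>n E. c * real (Y {1..n} E) \<le> real (X {1..n} E) \<and>
                     real (X {1..n} E) \<le> C * real (Y {1..n} E)))"

definition proper_colouring :: "'a set \<Rightarrow> 'a set set \<Rightarrow> ('a \<Rightarrow> nat) \<Rightarrow> bool" where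
  "proper_colouring V E f \<longleftrightarrow> (\<forall>u\<in>V. \<forall>v\<in>V. {u, v} \<in> E \<longrightarrow> f u \<noteq> f v)"

definition chromatic_number :: "'a set \<Rightarrow> 'a set set \<Rightarrow> nat" where
  "chromatic_number V E = (LEAST k. \<exists>f. f ` V \<subseteq> {..<k} \<and> proper_colouring V E f)"

text \<open>
  The game of Mr.\ Paint and Mrs.\ Correct. A position \<open>(U, r)\<close> consists of the set \<open>U\<close>
  of vertices not yet permanently coloured and the numbers \<open>r v\<close> of erasers left. Mr.\ Paint
  presents a nonempty set \<open>S \<subseteq> U\<close>; Mrs.\ Correct answers with the set \<open>K \<subseteq> S\<close> of vertices
  that keep the colour, erasing it from \<open>S - K\<close>.
\<close>

definition legal_reply :: "'a set set \<Rightarrow> ('a \<Rightarrow> nat) \<Rightarrow> 'a set \<Rightarrow> 'a set \<Rightarrow> bool" where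
  "legal_reply E r S K \<longleftrightarrow> K \<subseteq> S \<and> indep K E \<and> (\<forall>v \<in> S - K. r v > 0)"

text \<open>
  Mrs.\ Correct is stuck precisely if Mr.\ Paint presents two adjacent vertices without erasers,
  which is the condition under which Mr.\ Paint wins.
\<close>

lemma ex_legal_reply_iff:
  "(\<exists>K. legal_reply E r S K) \<longleftrightarrow>
   \<not> (\<exists>u\<in>S. \<exists>v\<in>S. u \<noteq> v \<and> {u, v} \<in> E \<and> r u = 0 \<and> r v = 0)"
proof
  assume "\<not> (\<exists>u\<in>S. \<exists>v\<in>S. u \<noteq> v \<and> {u, v} \<in> E \<and> r u = 0 \<and> r v = 0)"
  then have "indep {v \<in> S. r v = 0} E"
    unfolding indep_def by blast
  then have "legal_reply E r S {v \<in> S. r v = 0}"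
    by (simp add: legal_reply_def)
  then show "\<exists>K. legal_reply E r S K" ..
next
  assume "\<exists>K. legal_reply E r S K"
  then obtain K where K: "indep K E" "\<forall>v \<in> S - K. r v > 0"
    by (auto simp: legal_reply_def)
  show "\<not> (\<exists>u\<in>S. \<exists>v\<in>S. u \<noteq> v \<and> {u, v} \<in> E \<and> r u = 0 \<and> r v = 0)"
  proof
    assume "\<exists>u\<in>S. \<exists>v\<in>S. u \<noteq> v \<and> {u, v} \<in> E \<and> r u = 0 \<and> r v = 0"
    then obtain u v where "u \<in> S" "v \<in> S" "u \<noteq> v" "{u, v} \<in> E" "r u = 0" "r v = 0"
      by blast
    moreover from this have "u \<in> K" "v \<in> K" using K(2) by (metis DiffI less_irrefl)+
    ultimately show False using K(1) by (auto simp: indep_def)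
  qed
qed

text \<open>
  A strategy of Mrs.\ Correct maps the list of all sets presented so far (the current one last)
  to her reply. In \<open>play V r \<sigma> S i\<close>, the position before round \<open>i\<close>, Mr.\ Paint presents \<open>S j\<close>
  in round \<open>j\<close>.
\<close>

type_synonym 'a strategy = "'a set list \<Rightarrow> 'a set"

primrec play :: "'a set \<Rightarrow> ('a \<Rightarrow> nat) \<Rightarrow> 'a strategy \<Rightarrow> (nat \<Rightarrow> 'a set) \<Rightarrow> nat
    \<Rightarrow> 'a set \<times> ('a \<Rightarrow> nat)" where
  "play V r \<sigma> S 0 = (V, r)"
| "play V r \<sigma> S (Suc i) =
     (let K = \<sigma> (map S [0..<Suc i])
      in (fst (play V r \<sigma> S i) - K,
          \<lambda>v. if v \<in> S i - K then snd (play V r \<sigma> S i) v - 1 else snd (play V r \<sigma> S i) v))"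

text \<open>
  The moves \<open>S i\<close> are irrelevant once all vertices are permanently coloured.
\<close>

definition winning_strategy :: "'a set \<Rightarrow> 'a set set \<Rightarrow> ('a \<Rightarrow> nat) \<Rightarrow> 'a strategy \<Rightarrow> bool" where
  "winning_strategy V E r \<sigma> \<longleftrightarrow>
     (\<forall>S. (\<forall>i. fst (play V r \<sigma> S i) \<noteq> {} \<longrightarrow> S i \<noteq> {} \<and> S i \<subseteq> fst (play V r \<sigma> S i)) \<longrightarrow>
        (\<exists>m. fst (play V r \<sigma> S m) = {} \<and>
           (\<forall>i<m. legal_reply E (snd (play V r \<sigma> S i)) (S i) (\<sigma> (map S [0..<Suc i])))))"

text \<open>
  The requirement \<open>k \<ge> 1\<close> excludes \<open>k = 0\<close>, where \<open>k - 1\<close> would be truncated to \<open>0\<close>.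
\<close>

definition paintable :: "'a set \<Rightarrow> 'a set set \<Rightarrow> nat \<Rightarrow> bool" where
  "paintable V E k \<longleftrightarrow> k \<ge> 1 \<and> (\<exists>\<sigma>. winning_strategy V E (\<lambda>_. k - 1) \<sigma>)"

definition paintability :: "'a set \<Rightarrow> 'a set set \<Rightarrow> nat" where
  "paintability V E = (LEAST k. paintable V E k)"

end

theory Submission
  imports Defs
begin

text \<open>
  A \<open>k\<close>-degenerate graph is \<open>(k + 1)\<close>-paintable: order the vertices so that each has at most
  \<open>k\<close> earlier neighbours, and let Mrs.\ Correct keep the colour on the greedy independent subset
  of each presented set. Every erasure at a vertex is then paid for by an earlier neighbour that is
  permanently coloured in the same round, so \<open>k\<close> erasers suffice. If \<open>p \<le> c / n\<close> and \<open>k\<close> is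
  large compared with \<open>c\<close>, a first moment computation shows that a.a.s.\ every nonempty vertex set
  \<open>U\<close> spans fewer than \<open>k |U|\<close> edges, whence the graph is \<open>2k\<close>-degenerate and both parameters lie
  between \<open>1\<close> and \<open>2k + 1\<close>.
\<close>

section \<open>Degenerate graphs and vertex orderings\<close>

text \<open>The hereditary form is chosen over an elimination ordering: it passes to subsets at once
  and is what a sparsity bound yields directly. A loop \<open>{v}\<close> would count
  \<open>v\<close> as its own neighbour.\<close>

definition degenerate :: "'a set \<Rightarrow> 'a set set \<Rightarrow> nat \<Rightarrow> bool" where
  "degenerate V E k \<longleftrightarrow> (\<forall>U\<subseteq>V. U \<noteq> {} \<longrightarrow> (\<exists>v\<in>U. card {u \<in> U. {u, v} \<in> E} \<le> k))"

lemma degenerate_subset: "degenerate V E k \<Longrightarrow> W \<subseteq> V \<Longrightarrow> degenerate W E k"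
  unfolding degenerate_def by blast

text \<open>Deleting a vertex of small degree leaves a degenerate graph; read backwards, the graph
  grows by vertices that have few neighbours on arrival.\<close>

lemma degenerate_induct [consumes 2, case_names empty insert]:
  assumes "finite V" "degenerate V E k" and "P {}"
    and step: "\<And>v W. finite W \<Longrightarrow> v \<notin> W \<Longrightarrow> card {u \<in> insert v W. {u, v} \<in> E} \<le> k \<Longrightarrow>
      P W \<Longrightarrow> P (insert v W)"
  shows "P V"
  using assms(1,2)
proof (induction rule: finite_remove_induct)
  case empty
  show ?case by fact
next
  case (remove A)
  then obtain v where v: "v \<in> A" "card {u \<in> A. {u, v} \<in> E} \<le> k"
    unfolding degenerate_def by blast
  have "P (A - {v})"
    using remove v(1) degenerate_subset by blast
  then have "P (insert v (A - {v}))"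
    using remove v by (intro step) (auto simp: insert_absorb)
  then show ?case
    using v by (simp add: insert_absorb)
qed

text \<open>Each arriving vertex is placed last. Its earlier neighbours are then among its few
  neighbours on arrival, and those of the older vertices do not change.\<close>

lemma degenerate_imp_ordering:
  assumes "finite V" "degenerate V E k"
  shows "\<exists>g::'a \<Rightarrow> nat. inj_on g V \<and> (\<forall>v\<in>V. card {u \<in> V. {u, v} \<in> E \<and> g u < g v} \<le> k)"
  using assms
proof (induction rule: degenerate_induct)
  case empty
  show ?case by simp
next
  case (insert v W)
  then obtain g :: "'a \<Rightarrow> nat" where g: "inj_on g W"
    "\<And>w. w \<in> W \<Longrightarrow> card {u \<in> W. {u, w} \<in> E \<and> g u < g w} \<le> k"
    by blast
  \<comment> \<open>The inserted \<open>0\<close> keeps \<open>Max\<close> meaningful for empty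
    \<open>W\<close>; \<open>Suc\<close> puts \<open>v\<close> strictly after all of
    \<open>W\<close>.\<close>
  define h where "h = g(v := Suc (Max (insert 0 (g ` W))))"
  have less: "h w < h v" if "w \<in> W" for w
  proof -
    have "g w \<le> Max (insert 0 (g ` W))"
      using insert that by (intro Max_ge) auto
    then show ?thesis using that insert.hyps(2) by (auto simp: h_def)
  qed
  have eq: "h w = g w" if "w \<in> W" for w
    using that insert.hyps(2) by (auto simp: h_def)
  have "inj_on h (insert v W)"
    using g(1) less by (fastforce simp: inj_on_insert eq cong: inj_on_cong)
  moreover have "card {u \<in> insert v W. {u, w} \<in> E \<and> h u < h w} \<le> k" if "w \<in> insert v W" for w
  proof (cases "w = v")
    case True
    have "card {u \<in> insert v W. {u, w} \<in> E \<and> h u < h w} \<le> card {u \<in> insert v W. {u, v} \<in> E}"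
      using insert True by (intro card_mono) auto
    then show ?thesis using insert by simp
  next
    case False
    then have "w \<in> W" using that by simp
    then have "{u \<in> insert v W. {u, w} \<in> E \<and> h u < h w} = {u \<in> W. {u, w} \<in> E \<and> g u < g w}"
      using less[of w] by (auto simp: eq)
    then show ?thesis using g(2) \<open>w \<in> W\<close> by simp
  qed
  ultimately show ?case by blast
qed

section \<open>The greedy strategy in the painting game\<close>

text \<open>Scan \<open>S\<close> in increasing order of \<open>g\<close> and keep a vertex unless a
  kept neighbour blocks it; the blocking neighbour is then earlier.\<close>

lemma ex_greedy_indep:
  fixes g :: "'a \<Rightarrow> nat"
  assumes "finite S" "inj_on g S"
  shows "\<exists>K\<subseteq>S. indep K E \<and> (\<forall>v\<in>S - K. \<exists>u\<in>K. {u, v} \<in> E \<and> g u < g v)"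
  using assms
proof (induction S rule: finite_ranking_induct[where f = g])
  case empty
  show ?case by (simp add: indep_def)
next
  case (insert x S)
  then have "inj_on g S" by (meson inj_on_subset subset_insertI)
  then obtain K where K: "K \<subseteq> S" "indep K E"
    "\<forall>v\<in>S - K. \<exists>u\<in>K. {u, v} \<in> E \<and> g u < g v"
    using insert.IH by blast
  \<comment> \<open>The ranking induction gives only a weak inequality and allows \<open>x\<close>
    in \<open>S\<close>; injectivity of \<open>g\<close> makes it strict for \<open>u\<close> other
    than \<open>x\<close>.\<close>
  have less: "g u < g x" if "u \<in> S" "u \<noteq> x" for u
    using that insert by (metis inj_onD insertI1 insertI2 le_neq_implies_less)
  show ?case
  proof (cases "x \<in> K \<or> (\<exists>u\<in>K. {u, x} \<in> E \<and> u \<noteq> x)")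
    case True
    then show ?thesis using K less by (intro exI[of _ K]) blast
  next
    case False
    then show ?thesis using K
      by (intro exI[of _ "insert x K"]) (auto simp: indep_def insert_commute)
  qed
qed

lemma play_Suc:
  "play V r \<sigma> S (Suc i) = (let K = \<sigma> (map S [0..<Suc i]) in
     (fst (play V r \<sigma> S i) - K,
      \<lambda>v. snd (play V r \<sigma> S i) v - (if v \<in> S i - K then 1 else 0)))"
  by (simp add: Let_def fun_eq_iff del: upt_Suc)

text \<open>A potential argument: the erasers at \<open>v\<close> always cover the earlier
  neighbours of \<open>v\<close> still in play, since both counts fall when the colour is erased at
  \<open>v\<close>. The successor reflects that \<open>k\<close>-paintability grants
  \<open>k - 1\<close> erasers.\<close>

lemma ordering_imp_paintable:
  fixes g :: "'a \<Rightarrow> nat"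
  assumes fin: "finite V" and inj: "inj_on g V"
    and few: "\<And>v. v \<in> V \<Longrightarrow> card {u \<in> V. {u, v} \<in> E \<and> g u < g v} \<le> k"
  shows "paintable V E (Suc k)"
proof -
  define B where "B U v = {u \<in> U. {u, v} \<in> E \<and> g u < g v}" for U v
  obtain \<kappa> where \<kappa>: "\<And>S. S \<subseteq> V \<Longrightarrow> \<kappa> S \<subseteq> S \<and> indep (\<kappa> S) E \<and>
      (\<forall>v\<in>S - \<kappa> S. \<exists>u\<in>\<kappa> S. {u, v} \<in> E \<and> g u < g v)"
  proof -
    have "\<exists>K. S \<subseteq> V \<longrightarrow> K \<subseteq> S \<and> indep K E \<and> (\<forall>v\<in>S - K. \<exists>u\<in>K. {u, v} \<in> E \<and> g u < g v)" for S
      using ex_greedy_indep[of S g E] fin inj by (meson finite_subset inj_on_subset)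
    then show ?thesis using that by metis
  qed
  \<comment> \<open>The strategy is memoryless: only the set presented last matters.\<close>
  define \<sigma> where "\<sigma> = (\<lambda>h :: 'a set list. \<kappa> (last h))"
  have "winning_strategy V E (\<lambda>_. k) \<sigma>"
    unfolding winning_strategy_def
  proof (intro allI impI)
    fix S
    define U where "U i = fst (play V (\<lambda>_. k) \<sigma> S i)" for i
    define r where "r i = snd (play V (\<lambda>_. k) \<sigma> S i)" for i
    assume "\<forall>i. fst (play V (\<lambda>_. k) \<sigma> S i) \<noteq> {} \<longrightarrow> S i \<noteq> {} \<and> S i \<subseteq> fst (play V (\<lambda>_. k) \<sigma> S i)"
    then have S: "S i \<noteq> {}" "S i \<subseteq> U i" if "U i \<noteq> {}" for i
      using that by (auto simp: U_def)
    have \<sigma>: "\<sigma> (map S [0..<Suc i]) = \<kappa> (S i)" for i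
      by (simp add: \<sigma>_def)
    have init: "U 0 = V" "r 0 = (\<lambda>_. k)"
      by (simp_all add: U_def r_def)
    have U_Suc: "U (Suc i) = U i - \<kappa> (S i)"
      and r_Suc: "r (Suc i) v = r i v - (if v \<in> S i - \<kappa> (S i) then 1 else 0)" for i v
      unfolding U_def r_def play_Suc \<sigma> Let_def by simp_all
    have UV: "U i \<subseteq> V" for i
      by (induction i) (auto simp: init U_Suc)
    have finU: "finite (U i)" for i
      using UV fin finite_subset by blast
    have SV: "S i \<subseteq> V" if "U i \<noteq> {}" for i
      using S(2)[OF that] UV by blast
    \<comment> \<open>The earlier neighbour that blocks \<open>v\<close> keeps its colour and so
      leaves play, which makes the inclusion strict.\<close>
    have erased: "B (U i - \<kappa> (S i)) v \<subset> B (U i) v" if "v \<in> S i - \<kappa> (S i)" "U i \<noteq> {}" for i v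
      using \<kappa>[OF SV[OF that(2)]] that S(2)[OF that(2)] unfolding B_def by blast
    have finB: "finite (B (U i) v)" for i v
      using finU by (simp add: B_def)
    \<comment> \<open>Every uncoloured vertex has an eraser for each of its earlier neighbours still in play.\<close>
    have inv: "v \<in> U i \<Longrightarrow> card (B (U i) v) \<le> r i v" for i v
    proof (induction i)
      case 0
      then show ?case using few by (simp add: init B_def)
    next
      case (Suc i)
      then have v: "v \<in> U i" and IH: "card (B (U i) v) \<le> r i v" and ne: "U i \<noteq> {}"
        by (auto simp: U_Suc)
      show ?case
      proof (cases "v \<in> S i - \<kappa> (S i)")
        case True
        from psubset_card_mono[OF finB erased[OF True ne]] show ?thesis
          using IH True by (simp add: Suc(1) U_Suc r_Suc)
      next
        case False
        have "card (B (U i - \<kappa> (S i)) v) \<le> card (B (U i) v)"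
          using finB by (intro card_mono) (auto simp: B_def)
        then show ?thesis using IH False by (auto simp: U_Suc r_Suc)
      qed
    qed
    have legal: "legal_reply E (r i) (S i) (\<kappa> (S i))" if ne: "U i \<noteq> {}" for i
    proof -
      have "r i v > 0" if "v \<in> S i - \<kappa> (S i)" for v
      proof -
        \<comment> \<open>A proper subset exists, so an earlier neighbour is still in play; the
          invariant turns it into an available eraser.\<close>
        have "card (B (U i) v) > 0"
          using erased[OF that ne] finB by (metis card_gt_0_iff not_psubset_empty)
        moreover have "v \<in> U i" using that S(2)[OF ne] by blast
        ultimately show ?thesis using inv[of v i] by linarith
      qed
      then show ?thesis
        using \<kappa>[OF SV[OF ne]] by (auto simp: legal_reply_def)
    qed
    have decr: "card (U (Suc i)) < card (U i)" if ne: "U i \<noteq> {}" for i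
    proof -
      \<comment> \<open>If nothing were kept, a vertex of the nonempty \<open>S i\<close> would lack
        its blocking neighbour.\<close>
      have "\<kappa> (S i) \<noteq> {}" "\<kappa> (S i) \<subseteq> U i"
        using \<kappa>[OF SV[OF ne]] S[OF ne] by blast+
      then show ?thesis
        unfolding U_Suc using finU by (intro psubset_card_mono) auto
    qed
    have "\<exists>m. U m = {}"
    proof (rule ccontr)
      assume "\<nexists>m. U m = {}"
      \<comment> \<open>Every round colours at least one vertex, which bounds the length of the
        game.\<close>
      then have "card (U i) + i \<le> card V" for i
      proof (induction i)
        case (Suc i)
        then show ?case using decr[of i] by fastforce
      qed (simp add: init)
      from this[of "Suc (card V)"] show False by simp
    qed
    then obtain m where m: "U m = {}" "\<And>i. i < m \<Longrightarrow> U i \<noteq> {}"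
      using exists_least_iff[of "\<lambda>m. U m = {}"] by blast
    show "\<exists>m. fst (play V (\<lambda>_. k) \<sigma> S m) = {} \<and>
       (\<forall>i<m. legal_reply E (snd (play V (\<lambda>_. k) \<sigma> S i)) (S i) (\<sigma> (map S [0..<Suc i])))"
      using m legal unfolding \<sigma> U_def r_def by blast
  qed
  then show ?thesis
    by (auto simp: paintable_def)
qed

lemma degenerate_imp_paintable:
  assumes "finite V" "degenerate V E k"
  shows "paintable V E (Suc k)"
  using degenerate_imp_ordering[OF assms] ordering_imp_paintable[OF assms(1)] by blast

section \<open>Greedy colouring, and degeneracy from sparsity\<close>

text \<open>An arriving vertex sees at most \<open>k\<close> colours, so one of the
  \<open>k + 1\<close> available ones is free.\<close>

lemma degenerate_imp_colouring:
  assumes "finite V" "degenerate V E k" and no_loops: "\<And>v. {v} \<notin> E"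
  shows "\<exists>f. f ` V \<subseteq> {..<Suc k} \<and> proper_colouring V E f"
  using assms(1,2)
proof (induction rule: degenerate_induct)
  case empty
  show ?case by (simp add: proper_colouring_def)
next
  case (insert v W)
  then obtain f where f: "f ` W \<subseteq> {..<Suc k}" "proper_colouring W E f"
    by blast
  let ?N = "{u \<in> insert v W. {u, v} \<in> E}"
  have "card (f ` ?N) \<le> card ?N"
    using insert by (intro card_image_le) auto
  then have "\<not> {..<Suc k} \<subseteq> f ` ?N"
    using insert.hyps card_mono[of "f ` ?N" "{..<Suc k}"] by auto
  then obtain c where c: "c < Suc k" "c \<notin> f ` ?N"
    by blast
  have "proper_colouring (insert v W) E (f(v := c))"
    using f(2) c(2) no_loops insert.hyps(2)
    by (auto simp: proper_colouring_def insert_commute image_iff)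
  moreover have "(f(v := c)) ` insert v W \<subseteq> {..<Suc k}"
    using f(1) c(1) by auto
  ultimately show ?case by blast
qed


text \<open>Handshaking: if all degrees inside \<open>U\<close> exceeded \<open>2 * k\<close>, then
  \<open>U\<close> would span at least \<open>k * card U\<close> edges.\<close>

lemma few_edges_imp_degenerate:
  assumes "finite V" and no_loops: "\<And>v. {v} \<notin> E"
    and few: "\<And>U. U \<subseteq> V \<Longrightarrow> U \<noteq> {} \<Longrightarrow> card (E \<inter> [U]\<^bsup>2\<^esup>) < k * card U"
  shows "degenerate V E (2 * k)"
  unfolding degenerate_def
proof (intro allI impI, rule ccontr)
  fix U assume U: "U \<subseteq> V" "U \<noteq> {}" and "\<not> (\<exists>v\<in>U. card {u \<in> U. {u, v} \<in> E} \<le> 2 * k)"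
  \<comment> \<open>The weak inequality suffices, because \<open>few\<close> is strict.\<close>
  then have deg: "2 * k \<le> card {u \<in> U. {u, v} \<in> E}" if "v \<in> U" for v
    using that by force
  have fin: "finite U" using U assms finite_subset by blast
  let ?F = "E \<inter> [U]\<^bsup>2\<^esup>"
  have finF: "finite ?F" using fin by (simp add: finite_imp_finite_nsets)
  have "2 * k \<le> card {e \<in> ?F. v \<in> e}" if v: "v \<in> U" for v
  proof -
    have "card {u \<in> U. {u, v} \<in> E} \<le> card {e \<in> ?F. v \<in> e}"
    proof (rule card_inj_on_le[where f = "\<lambda>u. {u, v}"])
      show "inj_on (\<lambda>u. {u, v}) {u \<in> U. {u, v} \<in> E}"
        by (auto simp: inj_on_def doubleton_eq_iff)
      show "(\<lambda>u. {u, v}) ` {u \<in> U. {u, v} \<in> E} \<subseteq> {e \<in> ?F. v \<in> e}"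
        using v no_loops by (auto simp: nsets_def card_insert_if)
      show "finite {e \<in> ?F. v \<in> e}" by (rule finite_subset[OF _ finF]) auto
    qed
    then show ?thesis using deg[OF v] by linarith
  qed
  then have "2 * k * card U \<le> (\<Sum>v\<in>U. card {e \<in> ?F. v \<in> e})"
    using sum_bounded_below[of U "2 * k"] by (simp add: mult.commute)
  \<comment> \<open>Incidences of vertices and edges are counted from the side of the edges.\<close>
  also have "\<dots> = (\<Sum>e\<in>?F. card {v \<in> U. v \<in> e})"
    using sum.swap_restrict[OF fin finF, of "\<lambda>_ _. 1::nat" "\<lambda>v e. v \<in> e"] by simp
  also have "\<dots> = (\<Sum>e\<in>?F. 2)"
    by (intro sum.cong) (auto simp: nsets_def Collect_conj_eq Int_absorb1)
  also have "\<dots> < 2 * (k * card U)"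
    using few[OF U] by simp
  finally show False by simp
qed

section \<open>Exponential bounds for binomial coefficients\<close>

text \<open>One term of the series for \<open>exp m\<close> is at most its sum.\<close>

lemma power_self_le_exp_fact: "real m ^ m \<le> exp 1 ^ m * fact m"
proof -
  have "(\<Sum>i\<in>{m}. real m ^ i /\<^sub>R fact i) \<le> exp (real m)"
    unfolding exp_def by (intro sum_le_suminf summable_exp_generic) auto
  then have "real m ^ m \<le> exp (real m) * fact m"
    by (simp add: field_simps)
  then show ?thesis using exp_of_nat_mult[of m "1::real"] by simp
qed

lemma binomial_le_exp_power:
  assumes "m > 0"
  shows "real (N choose m) \<le> (exp 1 * real N / real m) ^ m"
proof -
  have "real (N choose m) * real m ^ m \<le> real (N choose m) * (exp 1 ^ m * fact m)"
    by (intro mult_left_mono power_self_le_exp_fact) auto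
  also have "\<dots> = exp 1 ^ m * real ((N choose m) * fact m)"
    by simp
  also have "\<dots> \<le> exp 1 ^ m * real (N ^ m)"
    by (intro mult_left_mono of_nat_mono binomial_fact_pow) auto
  finally show ?thesis
    using assms by (simp add: field_simps power_divide power_mult_distrib)
qed

section \<open>First moment bounds in the binomial random graph\<close>

text \<open>The event forces the coordinates in \<open>F\<close> and leaves the others free, so
  independence gives a product.\<close>

lemma prob_gnp_superset:
  assumes "0 \<le> p" "p \<le> 1" "F \<subseteq> [{1..n}]\<^bsup>2\<^esup>"
  shows "measure_pmf.prob (gnp n p) {E. F \<subseteq> E} = p ^ card F"
proof -
  let ?A = "[{1..n}]\<^bsup>2\<^esup>"
  have fin: "finite ?A" by (simp add: finite_imp_finite_nsets)
  have "measure_pmf.prob (gnp n p) {E. F \<subseteq> E} =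
      measure_pmf.prob (Pi_pmf ?A False (\<lambda>_. bernoulli_pmf p)) (Pi ?A (\<lambda>e. if e \<in> F then {True} else UNIV))"
    unfolding gnp_def measure_map_pmf
    using assms(3) by (intro arg_cong[where f = "measure_pmf.prob _"]) (auto simp: Pi_def split: if_splits)
  also have "\<dots> = (\<Prod>e\<in>?A. if e \<in> F then p else 1)"
    unfolding measure_Pi_pmf_Pi[OF fin] using assms
    by (intro prod.cong) (auto simp: measure_pmf_single)
  also have "\<dots> = p ^ card F"
    using fin assms(3) by (simp flip: prod.inter_restrict add: Int_absorb1)
  finally show ?thesis .
qed

text \<open>A union bound over pairs of an \<open>s\<close>-set \<open>U\<close> and a set
  \<open>F\<close> of exactly \<open>m\<close> pairs inside \<open>U\<close>: a dense
  \<open>U\<close> contains such an \<open>F\<close> all of whose pairs are edges.\<close>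

lemma prob_gnp_dense_le:
  assumes "0 \<le> p" "p \<le> 1"
  shows "measure_pmf.prob (gnp n p) {E. \<exists>U\<in>[{1..n}]\<^bsup>s\<^esup>. m \<le> card (E \<inter> [U]\<^bsup>2\<^esup>)}
    \<le> real (n choose s) * real ((s choose 2) choose m) * p ^ m"
proof -
  define I where "I = Sigma ([{1..n}]\<^bsup>s\<^esup>) (\<lambda>U. [[U]\<^bsup>2\<^esup>]\<^bsup>m\<^esup>)"
  have finI: "finite I"
    unfolding I_def by (intro finite_SigmaI finite_imp_finite_nsets) (auto simp: nsets_def)
  have "card I = (\<Sum>U\<in>[{1..n}]\<^bsup>s\<^esup>. (s choose 2) choose m)"
    unfolding I_def by (subst card_SigmaI) (auto simp: finite_imp_finite_nsets nsets_def[of _ s] intro!: sum.cong)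
  then have cardI: "card I = (n choose s) * ((s choose 2) choose m)"
    by simp
  have "measure_pmf.prob (gnp n p) {E. \<exists>U\<in>[{1..n}]\<^bsup>s\<^esup>. m \<le> card (E \<inter> [U]\<^bsup>2\<^esup>)}
      \<le> measure_pmf.prob (gnp n p) (\<Union>x\<in>I. {E. snd x \<subseteq> E})"
  proof (intro measure_pmf.finite_measure_mono subsetI)
    fix E assume "E \<in> {E. \<exists>U\<in>[{1..n}]\<^bsup>s\<^esup>. m \<le> card (E \<inter> [U]\<^bsup>2\<^esup>)}"
    then obtain U where U: "U \<in> [{1..n}]\<^bsup>s\<^esup>" "m \<le> card (E \<inter> [U]\<^bsup>2\<^esup>)"
      by blast
    obtain F where "F \<subseteq> E \<inter> [U]\<^bsup>2\<^esup>" "card F = m" "finite F"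
      using obtain_subset_with_card_n[OF U(2)] by blast
    then have "(U, F) \<in> I" "F \<subseteq> E"
      using U(1) by (auto simp: I_def nsets_def[of _ m])
    then show "E \<in> (\<Union>x\<in>I. {E. snd x \<subseteq> E})" by force
  qed auto
  also have "\<dots> \<le> (\<Sum>x\<in>I. measure_pmf.prob (gnp n p) {E. snd x \<subseteq> E})"
    by (intro measure_pmf.finite_measure_subadditive_finite finI) auto
  also have "\<dots> = (\<Sum>x\<in>I. p ^ m)"
  proof (intro sum.cong refl)
    fix x assume "x \<in> I"
    then have "fst x \<subseteq> {1..n}" "card (snd x) = m" "snd x \<subseteq> [fst x]\<^bsup>2\<^esup>"
      unfolding I_def by (auto simp: nsets_def[of _ s] nsets_def[of _ m])
    then have "card (snd x) = m" "snd x \<subseteq> [{1..n}]\<^bsup>2\<^esup>"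
      using nsets_mono by blast+
    then show "measure_pmf.prob (gnp n p) {E. snd x \<subseteq> E} = p ^ m"
      using prob_gnp_superset[OF assms] by metis
  qed
  finally show ?thesis by (simp add: cardI)
qed

text \<open>With \<open>y = s / n\<close>, the choice of \<open>U\<close> costs
  \<open>(e / y) ^ s\<close> and the edges gain \<open>(y / (2 * e)) ^ (2 * s)\<close>, leaving
  \<open>(y / (4 * e)) ^ s\<close>. The factor \<open>1 / n\<close> is for the limit, the geometric
  one for summing over \<open>s\<close>.\<close>

lemma expected_dense_sets_le:
  fixes p c :: real
  assumes p: "0 \<le> p" "p \<le> c / real n" and k: "2 \<le> k" "2 * exp 1 ^ 2 * c \<le> real k"
    and s: "1 \<le> s" "s \<le> n"
  shows "real (n choose s) * real ((s choose 2) choose (k * s)) * p ^ (k * s) \<le> (1 / real n) * (1 / 2) ^ s"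
proof -
  let ?e = "exp 1 :: real"
  define y where "y = real s / real n"
  have y: "0 < y" "y \<le> 1" and n: "real n > 0" and s0: "real s > 0" and k0: "real k > 0"
    using s k by (auto simp: y_def)
  have e: "1 \<le> ?e" by simp
  have "s choose 2 \<le> s * s"
    unfolding choose_two by (meson div_le_dividend diff_le_self le_trans mult_le_mono2)
  then have s2: "real (s choose 2) \<le> real s * real s"
    by (metis of_nat_le_iff of_nat_mult)
  have "real ((s choose 2) choose (k * s)) \<le> (?e * real (s choose 2) / real (k * s)) ^ (k * s)"
    using s k by (intro binomial_le_exp_power) auto
  also have "\<dots> \<le> (?e * (real s * real s) / real (k * s)) ^ (k * s)"
    using s2 by (intro power_mono divide_right_mono mult_left_mono) auto
  also have "\<dots> = (?e * real s / real k) ^ (k * s)"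
    using s0 by simp
  finally have 1: "real ((s choose 2) choose (k * s)) \<le> (?e * real s / real k) ^ (k * s)" .
  have "real ((s choose 2) choose (k * s)) * p ^ (k * s) \<le> (?e * real s / real k) ^ (k * s) * (c / real n) ^ (k * s)"
    using p by (intro mult_mono 1 power_mono) auto
  also have "\<dots> = (?e * c / real k * y) ^ (k * s)"
    by (simp add: y_def mult_ac flip: power_mult_distrib)
  also have "\<dots> \<le> (y / (2 * ?e)) ^ (k * s)"
  proof (intro power_mono)
    \<comment> \<open>Here \<open>k\<close> is large compared with \<open>c\<close>.\<close>
    have "?e * c / real k \<le> 1 / (2 * ?e)"
      using k(2) k0 by (simp add: field_simps power2_eq_square)
    then show "?e * c / real k * y \<le> y / (2 * ?e)"
      using y by (metis divide_inverse mult.commute mult_right_mono less_imp_le mult_1 divide_inverse)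
    have "0 \<le> c" using p n by (metis order_trans zero_le_divide_iff not_le)
    then show "0 \<le> ?e * c / real k * y" using y k0 by simp
  qed
  also have "\<dots> = ((y / (2 * ?e)) ^ k) ^ s"
    by (simp add: power_mult)
  \<comment> \<open>The base is at most 1, so the exponent may drop to 2: one factor
    \<open>y\<close> cancels the cost of choosing \<open>U\<close>, the other survives.\<close>
  also have "\<dots> \<le> ((y / (2 * ?e)) ^ 2) ^ s"
  proof (intro power_mono power_decreasing)
    have "y \<le> 2 * ?e" using y e by linarith
    then show "y / (2 * ?e) \<le> 1" by simp
  qed (use y k in auto)
  finally have 2: "real ((s choose 2) choose (k * s)) * p ^ (k * s) \<le> ((y / (2 * ?e)) ^ 2) ^ s" .
  have 3: "real (n choose s) \<le> (?e / y) ^ s"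
    using binomial_le_exp_power[of s n] s by (simp add: y_def)
  have "real (n choose s) * (real ((s choose 2) choose (k * s)) * p ^ (k * s))
      \<le> (?e / y) ^ s * ((y / (2 * ?e)) ^ 2) ^ s"
    using p y by (intro mult_mono 2 3) auto
  also have "\<dots> = (y / (4 * ?e)) ^ s"
    unfolding power_mult_distrib[symmetric] using y
    by (intro arg_cong[where f = "\<lambda>x. x ^ s"]) (simp add: power2_eq_square field_simps)
  also have "\<dots> \<le> (y / 4) ^ s"
    using y e by (intro power_mono divide_left_mono) auto
  also have "\<dots> = y ^ s * (1 / 4) ^ s"
    by (simp add: power_divide)
  \<comment> \<open>A single factor \<open>y = s / n\<close> is kept for the decay in
    \<open>n\<close>; its numerator is absorbed by weakening \<open>1 / 4\<close> to
    \<open>1 / 2\<close>.\<close>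
  also have "\<dots> \<le> y * (1 / 4) ^ s"
    using y s power_decreasing[of 1 s y] by (intro mult_right_mono) auto
  also have "\<dots> \<le> (1 / real n) * (1 / 2) ^ s"
  proof -
    have "s < 2 ^ s" by (rule less_exp)
    then have "real s \<le> 2 ^ s" by (metis less_imp_le of_nat_le_iff of_nat_numeral of_nat_power)
    then have "real s * (1 / 4) ^ s \<le> 2 ^ s * (1 / 4) ^ s" by (intro mult_right_mono) auto
    also have "\<dots> = (1 / 2) ^ s" by (simp flip: power_mult_distrib)
    finally show ?thesis using n by (simp add: y_def field_simps)
  qed
  finally show ?thesis by (simp add: mult.assoc)
qed

lemma set_pmf_gnp_subset: "E \<in> set_pmf (gnp n p) \<Longrightarrow> E \<subseteq> [{1..n}]\<^bsup>2\<^esup>"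
  by (auto simp: gnp_def)

text \<open>Sums the first moment bounds over all sizes of a dense set. The event also records that
  edges are pairs, so that later arguments can exclude loops.\<close>

lemma prob_gnp_not_degenerate_le:
  assumes p: "0 \<le> p" "p \<le> 1" "p \<le> c / real n" and k: "2 \<le> k" "2 * exp 1 ^ 2 * c \<le> real k"
  shows "measure_pmf.prob (gnp n p) {E. \<not> (E \<subseteq> [{1..n}]\<^bsup>2\<^esup> \<and> degenerate {1..n} E (2 * k))} \<le> 1 / real n"
proof -
  define D where "D s = {E. \<exists>U\<in>[{1..n}]\<^bsup>s\<^esup>. k * s \<le> card (E \<inter> [U]\<^bsup>2\<^esup>)}" for s
  have "measure_pmf.prob (gnp n p) {E. \<not> (E \<subseteq> [{1..n}]\<^bsup>2\<^esup> \<and> degenerate {1..n} E (2 * k))}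
      \<le> measure_pmf.prob (gnp n p) (\<Union>s\<in>{1..n}. D s)"
  \<comment> \<open>The inclusion of events is claimed only almost everywhere, as the sparsity
    criterion needs loop-free edge sets and the support guarantees them.\<close>
  proof (rule measure_pmf.finite_measure_mono_AE)
    have "E \<in> (\<Union>s\<in>{1..n}. D s)"
      if E: "E \<subseteq> [{1..n}]\<^bsup>2\<^esup>" and ndeg: "\<not> degenerate {1..n} E (2 * k)" for E
    proof -
      have "{v} \<notin> E" for v using E by (auto simp: nsets_def)
      then obtain U where U: "U \<subseteq> {1..n}" "U \<noteq> {}" "k * card U \<le> card (E \<inter> [U]\<^bsup>2\<^esup>)"
        using few_edges_imp_degenerate[of "{1..n}" E k] ndeg by (meson finite_atLeastAtMost not_le)
      have "finite U" using U(1) finite_subset by blast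
      then have "U \<in> [{1..n}]\<^bsup>card U\<^esup>" "card U \<in> {1..n}"
        using U card_mono[OF _ U(1)] by (auto simp: nsets_def Suc_le_eq card_gt_0_iff)
      then show ?thesis using U(3) unfolding D_def by blast
    qed
    then show "AE E in measure_pmf (gnp n p).
        E \<in> {E. \<not> (E \<subseteq> [{1..n}]\<^bsup>2\<^esup> \<and> degenerate {1..n} E (2 * k))} \<longrightarrow> E \<in> (\<Union>s\<in>{1..n}. D s)"
      using set_pmf_gnp_subset by (auto simp: AE_measure_pmf_iff)
  qed auto
  also have "\<dots> \<le> (\<Sum>s\<in>{1..n}. measure_pmf.prob (gnp n p) (D s))"
    by (intro measure_pmf.finite_measure_subadditive_finite) auto
  also have "\<dots> \<le> (\<Sum>s\<in>{1..n}. (1 / real n) * (1 / 2) ^ s)"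
  proof (intro sum_mono)
    fix s assume "s \<in> {1..n}"
    then show "measure_pmf.prob (gnp n p) (D s) \<le> (1 / real n) * (1 / 2) ^ s"
      unfolding D_def using order_trans[OF prob_gnp_dense_le[OF p(1,2)] expected_dense_sets_le[OF p(1,3) k]]
      by simp
  qed
  also have "\<dots> = (1 / real n) * (\<Sum>s\<in>{1..n}. (1 / 2) ^ s)"
    by (simp add: sum_distrib_left)
  also have "\<dots> \<le> (1 / real n) * 1"
    by (intro mult_left_mono) (simp_all add: sum_gp)
  finally show ?thesis by simp
qed

lemma aas_degenerate:
  assumes p: "\<And>n. 0 \<le> p n \<and> p n \<le> 1" and O: "p \<in> O(\<lambda>n. 1 / real n)"
  shows "\<exists>k. aas p (\<lambda>n E. E \<subseteq> [{1..n}]\<^bsup>2\<^esup> \<and> degenerate {1..n} E k)"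
proof -
  from O obtain c where c: "\<forall>\<^sub>F n in sequentially. norm (p n) \<le> c * norm (1 / real n)"
    by (elim landau_o.bigE)
  \<comment> \<open>The two bounds required of \<open>k\<close> by the first moment
    estimate.\<close>
  define k where "k = max 2 (nat \<lceil>2 * exp 1 ^ 2 * c\<rceil>)"
  have k: "2 \<le> k" "2 * exp 1 ^ 2 * c \<le> real k"
    unfolding k_def by (simp, linarith)
  let ?P = "\<lambda>n. measure_pmf.prob (gnp n (p n)) {E. E \<subseteq> [{1..n}]\<^bsup>2\<^esup> \<and> degenerate {1..n} E (2 * k)}"
  have lower: "\<forall>\<^sub>F n in sequentially. 1 - 1 / real n \<le> ?P n"
    using c
  proof eventually_elim
    case (elim n)
    have "p n \<le> c / real n" using elim by simp
    from prob_gnp_not_degenerate_le[OF _ _ this k] p[of n] show ?case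
      using measure_pmf.prob_neg[of "gnp n (p n)" "\<lambda>E. E \<subseteq> [{1..n}]\<^bsup>2\<^esup> \<and> degenerate {1..n} E (2 * k)"]
      by simp
  qed
  have "(\<lambda>n. 1 - 1 / real n) \<longlonglongrightarrow> 1 - 0"
    by (intro tendsto_diff tendsto_const lim_1_over_n)
  then have "?P \<longlonglongrightarrow> 1"
    using lower by (intro tendsto_sandwich[of "\<lambda>n. 1 - 1 / real n" ?P _ "\<lambda>_. 1"]) auto
  then show ?thesis unfolding aas_def by blast
qed

section \<open>Transfer to the two graph parameters\<close>

text \<open>The limit ignores \<open>n = 0\<close>, where the chromatic number is 0 and the lower
  bound would fail.\<close>

lemma aas_mono:
  assumes "aas p P" and "\<And>n E. n > 0 \<Longrightarrow> P n E \<Longrightarrow> Q n E"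
  shows "aas p Q"
proof -
  have "\<forall>\<^sub>F n in sequentially. measure_pmf.prob (gnp n (p n)) {E. P n E} \<le> measure_pmf.prob (gnp n (p n)) {E. Q n E}"
    using eventually_gt_at_top[of 0]
    by eventually_elim (use assms(2) in \<open>auto intro!: measure_pmf.finite_measure_mono\<close>)
  from tendsto_sandwich[OF this _ assms(1)[unfolded aas_def] tendsto_const] show ?thesis
    unfolding aas_def by simp
qed

theorem theorem3:
  fixes p :: "nat \<Rightarrow> real"
  assumes "\<And>n. 0 \<le> p n \<and> p n \<le> 1"
    and "p \<in> O(\<lambda>n. 1 / real n)"
  shows "aas_bigtheta p paintability (\<lambda>_ _. 1) \<and>
         aas_bigtheta p paintability chromatic_number"
proof -
  obtain k where k: "aas p (\<lambda>n E. E \<subseteq> [{1..n}]\<^bsup>2\<^esup> \<and> degenerate {1..n} E k)"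
    using aas_degenerate[OF assms] by blast
  have "aas p (\<lambda>n E. paintability {1..n} E \<in> {1..Suc k} \<and> chromatic_number {1..n} E \<in> {1..Suc k})"
  proof (rule aas_mono[OF k])
    fix n :: nat and E
    assume n: "n > 0" and E: "E \<subseteq> [{1..n}]\<^bsup>2\<^esup> \<and> degenerate {1..n} E k"
    have "paintable {1..n} E (Suc k)"
      using E by (intro degenerate_imp_paintable) auto
    \<comment> \<open>The least value is itself paintable, hence at least 1 by definition.\<close>
    then have 1: "paintability {1..n} E \<le> Suc k" "paintable {1..n} E (paintability {1..n} E)"
      unfolding paintability_def by (rule Least_le, rule LeastI)
    have "{v} \<notin> E" for v using E by (auto simp: nsets_def)
    then have col: "\<exists>f. f ` {1..n} \<subseteq> {..<Suc k} \<and> proper_colouring {1..n} E f"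
      using E by (intro degenerate_imp_colouring) auto
    then have 2: "chromatic_number {1..n} E \<le> Suc k"
      unfolding chromatic_number_def by (rule Least_le)
    from col have "\<exists>f. f ` {1..n} \<subseteq> {..<chromatic_number {1..n} E} \<and> proper_colouring {1..n} E f"
      unfolding chromatic_number_def by (rule LeastI)
    \<comment> \<open>A nonempty vertex set has no map into the empty set of colours.\<close>
    then have "chromatic_number {1..n} E \<noteq> 0"
      using n by fastforce
    with 1 2 show "paintability {1..n} E \<in> {1..Suc k} \<and> chromatic_number {1..n} E \<in> {1..Suc k}"
      by (simp add: paintable_def)
  qed
  note bounded = this
  have "aas_bigtheta p paintability (\<lambda>_ _. 1)"
    unfolding aas_bigtheta_def
    by (rule exI[of _ 1], rule exI[of _ "real (Suc k)"]) (auto intro: aas_mono[OF bounded])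
  moreover have "aas_bigtheta p paintability chromatic_number"
    unfolding aas_bigtheta_def
  \<comment> \<open>Both parameters lie in \<open>{1..Suc k}\<close>, so their ratio lies between
    \<open>1 / Suc k\<close> and \<open>Suc k\<close>.\<close>
  proof (rule exI[of _ "1 / real (Suc k)"], rule exI[of _ "real (Suc k)"], intro conjI aas_mono[OF bounded])
    fix n :: nat and E
    assume *: "paintability {1..n} E \<in> {1..Suc k} \<and> chromatic_number {1..n} E \<in> {1..Suc k}"
    then have "chromatic_number {1..n} E \<le> Suc k * paintability {1..n} E"
      by (metis atLeastAtMost_iff mult_le_mono mult_1_right)
    then have "real (chromatic_number {1..n} E) \<le> real (Suc k) * real (paintability {1..n} E)"
      by (metis of_nat_le_iff of_nat_mult)
    then show "1 / real (Suc k) * real (chromatic_number {1..n} E) \<le> real (paintability {1..n} E)"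
      by (simp add: field_simps)
    from * have "paintability {1..n} E \<le> Suc k * chromatic_number {1..n} E"
      by (metis atLeastAtMost_iff mult_le_mono mult_1_right)
    then show "real (paintability {1..n} E) \<le> real (Suc k) * real (chromatic_number {1..n} E)"
      by (metis of_nat_le_iff of_nat_mult)
  qed auto
  ultimately show ?thesis by blast
qed

end
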